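(* Let the sequence $(b_0,b_1,\ldots)$ be defined by $b_0:=0$ and $b_k:=(2k-1)E_{2k-2}$ for $k\ge1$, where $E_j$ are the Euler numbers. Then for all $n\ge1$, $$H_n(b_k)=\frac{(-1)^n}{(2^n n!)^4}\cdot h_n\cdot H_n\big((2k+1)E_{2k}\big),$$ where the sequence $(h_n)_{n\ge0}$ is defined by $h_0=0$, $h_1=1$, and for $n\ge1$ $$h_{n+1}=(8n^2+8n+3)h_n-(2n)^4h_{n-1}.$$
   Context: For a sequence $(a_k)_{k\ge 0}$ and $n\ge 0$, $H_n(a_k):=\det(a_{i+j})_{0\le i,j\le n}$ denotes the $(n+1)\times(n+1)$ Hankel determinant; $H_n((2k+1)E_{2k})$ is the Hankel determinant of the sequence $((2k+1)E_{2k})_{k\ge0}$. The Euler numbers are defined by $\frac{2}{e^t+e^{-t}}=\sum_{n\ge0}E_n\frac{t^n}{n!}$. *)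

theory Defs
  imports
    "HOL-Computational_Algebra.Formal_Power_Series"
    "Jordan_Normal_Form.Determinant"
begin

text \<open>Coefficients of the exponential generating function $2/(e^t+e^{-t})$ as a formal
  power series. The division is by a unit, since the
  denominator has constant coefficient 2.\<close>

definition euler_number :: "nat \<Rightarrow> real" where
  "euler_number n = fact n * fps_nth (2 / (fps_exp 1 + fps_exp (- 1))) n"

definition hankel_det :: "nat \<Rightarrow> (nat \<Rightarrow> real) \<Rightarrow> real" where
  "hankel_det n a = det (mat (n + 1) (n + 1) (\<lambda>(i, j). a (i + j)))"

end

theory Submission
  imports Defs
begin

text \<open>Put \<open>c k = (2 * k + 1) * E\<^sub>2\<^sub>k\<close>. The monic orthogonal polynomials \<open>q n\<close> of the moment functional
  \<open>x ^ k \<mapsto> c k\<close> satisfy \<open>q (n + 1) = (x + \<sigma> n) * q n - \<tau> n * q (n - 1)\<close> with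
  \<open>\<sigma> n = 8 * n\<^sup>2 + 8 * n + 3\<close> and \<open>\<tau> n = (2 * n) ^ 4\<close>, so the Hankel determinant of \<open>c\<close> is a product
  of the \<open>\<tau> k\<close>. Since \<open>b (k + 1) = c k\<close>, the Hankel matrix of \<open>b\<close> becomes tridiagonal in the monic
  basis \<open>1, x * q 0, x * q 1, \<dots>\<close>, and the continuant recurrence for its determinant is, up to
  normalisation, the recurrence of \<open>h\<close>.\<close>

section \<open>Moment functionals on real polynomials\<close>

definition moment :: "(nat \<Rightarrow> real) \<Rightarrow> real poly \<Rightarrow> real" where
  "moment c p = (\<Sum>i\<le>degree p. coeff p i * c i)"

lemma moment_eq_sum:
  assumes "degree p \<le> n"
  shows "moment c p = (\<Sum>i\<le>n. coeff p i * c i)"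
  unfolding moment_def
  by (rule sum.mono_neutral_left) (use assms in \<open>auto simp: coeff_eq_0\<close>)

lemma moment_0 [simp]: "moment c 0 = 0"
  by (simp add: moment_def)

lemma moment_monom [simp]: "moment c (monom a n) = a * c n"
proof -
  have "moment c (monom a n) = (\<Sum>i\<le>n. if n = i then a * c i else 0)"
    unfolding moment_eq_sum[OF degree_monom_le] by (rule sum.cong) auto
  then show ?thesis
    by simp
qed

lemma moment_add: "moment c (p + q) = moment c p + moment c q"
proof -
  let ?n = "max (degree p) (degree q)"
  have "degree (p + q) \<le> ?n"
    by (rule degree_add_le) auto
  then show ?thesis
    by (simp add: moment_eq_sum[of _ ?n] sum.distrib ring_distribs)
qed

lemma moment_smult: "moment c (smult a p) = a * moment c p"
  by (simp add: moment_eq_sum[of _ "degree p"] sum_distrib_left mult.assoc)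

lemma moment_diff: "moment c (p - q) = moment c p - moment c q"
  using moment_add[of c p "smult (-1) q"] moment_smult[of c "-1" q] by simp

lemma moment_sum: "moment c (\<Sum>i\<in>A. f i) = (\<Sum>i\<in>A. moment c (f i))"
  by (induction A rule: infinite_finite_induct) (simp_all add: moment_add)

lemma moment_1: "moment c 1 = c 0"
  by (simp add: moment_def)

text \<open>Multiplying by \<open>x\<close> shifts the sequence; this is how moments of
  \<open>b\<close> become moments of \<open>c\<close>.\<close>

lemma moment_pCons_0: "moment c (pCons 0 p) = moment (\<lambda>k. c (Suc k)) p"
proof -
  have "moment c (pCons 0 p) = (\<Sum>i\<le>Suc (degree p). coeff (pCons 0 p) i * c i)"
    by (rule moment_eq_sum) (simp add: degree_pCons_le)
  then show ?thesis
    unfolding sum.atMost_Suc_shift by (simp add: moment_def)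
qed

lemma moment_mult_eq_sum:
  assumes "degree p \<le> n" "degree q \<le> n"
  shows "moment c (p * q) = (\<Sum>k\<le>n. \<Sum>l\<le>n. coeff p k * c (k + l) * coeff q l)"
proof -
  have p: "p = (\<Sum>k\<le>n. monom (coeff p k) k)"
    by (metis assms(1) poly_as_sum_of_monoms')
  have q: "q = (\<Sum>l\<le>n. monom (coeff q l) l)"
    by (metis assms(2) poly_as_sum_of_monoms')
  have "p * q = (\<Sum>k\<le>n. \<Sum>l\<le>n. monom (coeff p k * coeff q l) (k + l))"
    by (subst p, subst q) (simp add: sum_product mult_monom)
  then show ?thesis
    by (simp add: moment_sum mult_ac)
qed

section \<open>Change of basis for Hankel matrices, and tridiagonal determinants\<close>

lemma det_lower_unitriangular:
  fixes A :: "'a :: comm_ring_1 mat"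
  assumes "A \<in> carrier_mat n n" "\<And>i j. i < j \<Longrightarrow> j < n \<Longrightarrow> A $$ (i, j) = 0"
    and "\<And>i. i < n \<Longrightarrow> A $$ (i, i) = 1"
  shows "det A = 1"
proof -
  have "diag_mat A = map (\<lambda>i. 1) [0..<n]"
    unfolding diag_mat_def using assms by auto
  then show ?thesis
    using det_lower_triangular[of n A] assms by (simp add: map_replicate_const)
qed

text \<open>The Hankel matrix \<open>A\<close> is the Gram matrix of the monomials. Passing to the
  basis \<open>r\<close> turns it into \<open>P * A * P^T\<close>, where the coefficient matrix
  \<open>P\<close> is unitriangular by the degree and monicity assumptions.\<close>

lemma hankel_det_monic_basis:
  assumes deg: "\<And>i. degree (r i) = i" and monic: "\<And>i. coeff (r i) i = 1"
  shows "hankel_det n c = det (mat (n + 1) (n + 1) (\<lambda>(i, j). moment c (r i * r j)))"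
proof -
  let ?P = "mat (n + 1) (n + 1) (\<lambda>(i, k). coeff (r i) k)"
  let ?A = "mat (n + 1) (n + 1) (\<lambda>(i, j). c (i + j))"
  have P: "?P \<in> carrier_mat (n + 1) (n + 1)" and A: "?A \<in> carrier_mat (n + 1) (n + 1)"
    by auto
  have "mat (n + 1) (n + 1) (\<lambda>(i, j). moment c (r i * r j)) = ?P * (?A * transpose_mat ?P)"
  proof (rule eq_matI)
    fix i j assume "i < dim_row (?P * (?A * transpose_mat ?P))"
      "j < dim_col (?P * (?A * transpose_mat ?P))"
    then have ij: "i \<le> n" "j \<le> n" by auto
    have "moment c (r i * r j) = (\<Sum>k\<le>n. \<Sum>l\<le>n. coeff (r i) k * c (k + l) * coeff (r j) l)"
      by (rule moment_mult_eq_sum) (use ij deg in auto)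
    also have "\<dots> = (\<Sum>k<Suc n. coeff (r i) k * (\<Sum>l<Suc n. c (k + l) * coeff (r j) l))"
      by (simp only: sum_distrib_left lessThan_Suc_atMost mult.assoc)
    finally show "mat (n + 1) (n + 1) (\<lambda>(i, j). moment c (r i * r j)) $$ (i, j) =
        (?P * (?A * transpose_mat ?P)) $$ (i, j)"
      using ij by (simp add: scalar_prod_def atLeast0LessThan)
  qed auto
  moreover have "det ?P = 1"
    by (rule det_lower_unitriangular[OF P]) (auto simp: deg monic coeff_eq_0)
  ultimately show ?thesis
    by (simp only: hankel_det_def det_mult[OF P mult_carrier_mat[OF A transpose_carrier_mat[THEN iffD2, OF P]]]
        det_mult[OF A transpose_carrier_mat[THEN iffD2, OF P]] det_transpose[OF P])
qed

text \<open>Expand along the last row, which has only two possibly nonzero entries; the minor of the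
  off-diagonal one is then expanded along its last column, where only the bottom entry
  survives.\<close>

lemma det_tridiagonal_Suc_Suc:
  fixes f :: "nat \<Rightarrow> nat \<Rightarrow> 'a :: comm_ring_1"
  assumes "\<And>i j. i + 1 < j \<Longrightarrow> f i j = 0" "\<And>i j. j + 1 < i \<Longrightarrow> f i j = 0"
  shows "det (mat (m + 2) (m + 2) (\<lambda>(i, j). f i j)) =
    f (m + 1) (m + 1) * det (mat (m + 1) (m + 1) (\<lambda>(i, j). f i j)) -
    f (m + 1) m * f m (m + 1) * det (mat m m (\<lambda>(i, j). f i j))"
proof -
  let ?T = "\<lambda>k. mat k k (\<lambda>(i, j). f i j)"
  let ?U = "mat_delete (?T (m + 2)) (m + 1) m"
  have U: "?U \<in> carrier_mat (m + 1) (m + 1)"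
    by (auto simp: mat_delete_def)
  have "det ?U = (\<Sum>i<m + 1. ?U $$ (i, m) * cofactor ?U i m)"
    by (rule laplace_expansion_column[OF U]) simp
  also have "\<dots> = ?U $$ (m, m) * cofactor ?U m m"
    by (simp add: mat_delete_def assms)
  also have "mat_delete ?U m m = ?T m"
    by (rule eq_matI) (auto simp: mat_delete_def)
  then have "?U $$ (m, m) * cofactor ?U m m = f m (m + 1) * det (?T m)"
    by (simp add: cofactor_def) (simp add: mat_delete_def)
  finally have detU: "det ?U = f m (m + 1) * det (?T m)" .
  have *: "mat_delete (?T (m + 2)) (m + 1) (m + 1) = ?T (m + 1)"
    by (rule eq_matI) (auto simp: mat_delete_def)
  have "det (?T (m + 2)) = (\<Sum>j<m + 2. ?T (m + 2) $$ (m + 1, j) * cofactor (?T (m + 2)) (m + 1) j)"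
    by (rule laplace_expansion_row) auto
  also have "\<dots> = (\<Sum>j\<in>{m, m + 1}. ?T (m + 2) $$ (m + 1, j) * cofactor (?T (m + 2)) (m + 1) j)"
    by (rule sum.mono_neutral_right) (auto simp: assms)
  also have "\<dots> = f (m + 1) m * - det ?U + f (m + 1) (m + 1) * det (?T (m + 1))"
    using * by (simp add: cofactor_def)
  finally show ?thesis
    unfolding detU by (simp add: algebra_simps)
qed

section \<open>Orthogonal polynomials from a three-term recurrence\<close>

text \<open>With the sign \<open>+ \<sigma>\<close>, the values at \<open>x = 0\<close> obey the
  recurrence of \<open>h\<close>, only with other initial values.\<close>

fun opoly :: "(nat \<Rightarrow> real) \<Rightarrow> (nat \<Rightarrow> real) \<Rightarrow> nat \<Rightarrow> real poly" where
  "opoly \<sigma> \<tau> 0 = 1"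
| "opoly \<sigma> \<tau> (Suc 0) = [:\<sigma> 0, 1:]"
| "opoly \<sigma> \<tau> (Suc (Suc n)) =
    [:\<sigma> (Suc n), 1:] * opoly \<sigma> \<tau> (Suc n) - smult (\<tau> (Suc n)) (opoly \<sigma> \<tau> n)"

lemma opoly_monic: "degree (opoly \<sigma> \<tau> n) = n \<and> coeff (opoly \<sigma> \<tau> n) n = 1"
proof (induction \<sigma> \<tau> n rule: opoly.induct)
  case (3 \<sigma> \<tau> n)
  let ?a = "[:\<sigma> (Suc n), 1:] * opoly \<sigma> \<tau> (Suc n)" and ?b = "smult (\<tau> (Suc n)) (opoly \<sigma> \<tau> n)"
  have "opoly \<sigma> \<tau> (Suc n) \<noteq> 0"
    using 3 by auto
  then have a: "degree ?a = Suc (Suc n)"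
    using 3 by (subst degree_mult_eq) auto
  have "coeff ?a (Suc (Suc n)) = 1"
    using 3 by (simp add: coeff_eq_0)
  moreover have b: "degree ?b < Suc (Suc n)"
    using 3 degree_smult_le[of "\<tau> (Suc n)" "opoly \<sigma> \<tau> n"] by linarith
  ultimately have c: "coeff (?a - ?b) (Suc (Suc n)) = 1"
    using coeff_eq_0[OF b] by simp
  have "degree (?a - ?b) \<le> Suc (Suc n)"
    by (rule degree_diff_le) (use a b in auto)
  moreover have "degree (?a - ?b) \<ge> Suc (Suc n)"
    by (rule le_degree) (use c in simp)
  ultimately show ?case
    using c by (simp only: opoly.simps) simp
qed auto

text \<open>The recurrence read as the tridiagonal action of multiplication by \<open>x\<close>. The
  case \<open>n = 0\<close> is split off because \<open>n - 1\<close> truncates.\<close>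

lemma pCons_0_opoly:
  "pCons 0 (opoly \<sigma> \<tau> n) = opoly \<sigma> \<tau> (Suc n) - smult (\<sigma> n) (opoly \<sigma> \<tau> n)
     + (if n = 0 then 0 else smult (\<tau> n) (opoly \<sigma> \<tau> (n - 1)))"
  by (cases n) simp_all

text \<open>Multiplication by \<open>x\<close> is self-adjoint for \<open>moment c (p * q)\<close>.
  Applying the recurrence to either factor therefore relates the columns of the Gram matrix, and the
  hypothesis supplies column 0.\<close>

lemma opoly_orthogonal:
  assumes "\<And>n. moment c (opoly \<sigma> \<tau> n) = (if n = 0 then 1 else 0)"
  shows "moment c (opoly \<sigma> \<tau> i * opoly \<sigma> \<tau> j) = (if i = j then \<Prod>k<i. \<tau> (Suc k) else 0)"
proof -
  define q where "q = opoly \<sigma> \<tau>"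
  define a where "a i j = moment c (q i * q j)" for i j
  have x: "moment c (pCons 0 (q i) * q j) =
      a (Suc i) j - \<sigma> i * a i j + (if i = 0 then 0 else \<tau> i * a (i - 1) j)" for i j
    unfolding q_def pCons_0_opoly
    by (simp add: a_def q_def[symmetric] ring_distribs moment_add moment_diff moment_smult)
  have sym: "a i j = a j i" for i j
    by (simp add: a_def mult.commute)
  have comm: "pCons 0 (q i) * q j = pCons 0 (q j) * q i" for i j
    by (simp add: mult.commute)
  \<comment> \<open>Equate the expansions of \<open>x * q i * q j\<close> obtained from the left and
    from the right factor, and solve for column \<open>j + 1\<close>.\<close>
  have rec: "a i (Suc j) = a (Suc i) j + (\<sigma> j - \<sigma> i) * a i j
      + (if i = 0 then 0 else \<tau> i * a (i - 1) j) - (if j = 0 then 0 else \<tau> j * a i (j - 1))" for i j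
    using x[of i j] x[of j i] comm[of i j] sym[of i "Suc j"] sym[of i j] sym[of i "j - 1"]
    by (simp add: algebra_simps split: if_splits)
  have "\<forall>i. a i j = (if i = j then \<Prod>k<i. \<tau> (Suc k) else 0)"
  proof (induction j rule: less_induct)
    case (less j)
    show ?case
    proof (cases j)
      case 0
      then show ?thesis
        by (simp add: a_def q_def assms)
    next
      case (Suc m)
      have m: "a i m = (if i = m then \<Prod>k<i. \<tau> (Suc k) else 0)" for i
        using less Suc by simp
      have m': "a i (m - 1) = (if i = m - 1 then \<Prod>k<i. \<tau> (Suc k) else 0)" if "m \<noteq> 0" for i
        using less Suc that by simp
      show ?thesis
      proof
        fix i
        show "a i j = (if i = j then \<Prod>k<i. \<tau> (Suc k) else 0)"
          \<comment> \<open>At \<open>i = m + 1\<close> the term \<open>\<tau> i * a m m\<close>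
            gives the next norm. At \<open>i = m\<close> the factor
            \<open>\<sigma> m - \<sigma> i\<close> vanishes, and at \<open>i = m - 1\<close> the two
            remaining terms cancel.\<close>
          unfolding Suc rec[of i m] m
          using m'[of i] by (cases m; cases i) (auto simp: mult.commute)
      qed
    qed
  qed
  then show ?thesis
    by (simp add: a_def q_def)
qed

lemma hankel_det_opoly:
  assumes "\<And>n. moment c (opoly \<sigma> \<tau> n) = (if n = 0 then 1 else 0)"
  shows "hankel_det n c = (\<Prod>i\<le>n. \<Prod>k<i. \<tau> (Suc k))"
proof -
  let ?D = "mat (n + 1) (n + 1) (\<lambda>(i, j). if i = j then \<Prod>k<i. \<tau> (Suc k) else 0)"
  have "hankel_det n c = det ?D"
    by (subst hankel_det_monic_basis[of "opoly \<sigma> \<tau>"])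
      (simp_all add: opoly_monic opoly_orthogonal[OF assms])
  also have "\<dots> = prod_list (diag_mat ?D)"
    by (rule det_lower_triangular[of "n + 1"]) auto
  also have "diag_mat ?D = map (\<lambda>i. \<Prod>k<i. \<tau> (Suc k)) [0..<n + 1]"
    by (auto simp: diag_mat_def)
  also have "prod_list \<dots> = (\<Prod>i\<le>n. \<Prod>k<i. \<tau> (Suc k))"
    by (subst prod.distinct_set_conv_list[symmetric])
      (simp_all add: atLeast0LessThan flip: lessThan_Suc_atMost)
  finally show ?thesis .
qed

text \<open>In the basis \<open>1, x * q 0, x * q 1, ...\<close> one factor \<open>x\<close> is
  absorbed by the shift from \<open>b\<close> to \<open>c\<close>, and the other acts through the
  recurrence. The Gram matrix is thus tridiagonal, with corner \<open>b 0 = 0\<close>.\<close>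

lemma hankel_det_shifted_opoly:
  assumes mom: "\<And>n. moment (\<lambda>k. b (Suc k)) (opoly \<sigma> \<tau> n) = (if n = 0 then 1 else 0)"
    and b_0: "b 0 = 0"
    and h_0: "h 0 = 0" and h_1: "h 1 = 1"
    and h_rec: "\<And>n. h (n + 2) = \<sigma> (n + 1) * h (n + 1) - \<tau> (n + 1) * h n"
  shows "hankel_det n b = (- 1) ^ n * h n * (\<Prod>i<n. \<Prod>k<i. \<tau> (Suc k))"
proof -
  define N where "N i = (\<Prod>k<i. \<tau> (Suc k))" for i
  define r where "r i = (case i of 0 \<Rightarrow> 1 | Suc j \<Rightarrow> pCons 0 (opoly \<sigma> \<tau> j))" for i
  define f where "f i j = moment b (r i * r j)" for i j
  have N_Suc: "N (Suc i) = \<tau> (Suc i) * N i" for i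
    by (simp add: N_def)
  have orth: "moment (\<lambda>k. b (Suc k)) (opoly \<sigma> \<tau> i * opoly \<sigma> \<tau> j) = (if i = j then N i else 0)" for i j
    unfolding N_def by (rule opoly_orthogonal[OF mom])
  have nz: "opoly \<sigma> \<tau> j \<noteq> 0" for j
    using opoly_monic[of \<sigma> \<tau> j] by auto
  have r: "degree (r i) = i" "coeff (r i) i = 1" for i
    by (auto simp: r_def opoly_monic nz split: nat.split)
  have f_Suc: "f (Suc i) (Suc j) = moment (\<lambda>k. b (Suc k)) (pCons 0 (opoly \<sigma> \<tau> i) * opoly \<sigma> \<tau> j)" for i j
    by (simp add: f_def r_def moment_pCons_0)
  have f_Suc': "f (Suc i) (Suc j) = (if Suc i = j then N j else 0) - \<sigma> i * (if i = j then N i else 0)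
      + (if i = Suc j then \<tau> i * N j else 0)" for i j
    unfolding f_Suc pCons_0_opoly
    by (cases i) (simp_all del: opoly.simps
      add: ring_distribs moment_add moment_diff moment_smult orth)
  have f_0_Suc: "f 0 (Suc j) = (if j = 0 then 1 else 0)" "f (Suc j) 0 = (if j = 0 then 1 else 0)" for j
    by (simp_all add: f_def r_def moment_pCons_0 mom)
  have f_00: "f 0 0 = 0"
    by (simp add: f_def r_def moment_1 b_0)
  have N_0: "N 0 = 1"
    by (simp add: N_def)
  have tri: "f i j = 0" if "i + 1 < j \<or> j + 1 < i" for i j
    using that by (cases i; cases j) (auto simp: f_Suc' f_0_Suc)
  \<comment> \<open>The border entry \<open>f 0 1 = 1\<close> equals \<open>N 0\<close>, so one
    formula covers the whole off-diagonal.\<close>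
  have up: "f i (Suc i) = N i" and down: "f (Suc i) i = N i" for i
    by (cases i; simp add: f_Suc' f_0_Suc N_0 N_Suc)+
  have diag: "f (Suc i) (Suc i) = - \<sigma> i * N i" for i
    by (simp add: f_Suc')
  define d where "d m = det (mat m m (\<lambda>(i, j). f i j))" for m
  have d_rec: "d (m + 2) = f (m + 1) (m + 1) * d (m + 1) - f (m + 1) m * f m (m + 1) * d m" for m
    unfolding d_def by (rule det_tridiagonal_Suc_Suc) (use tri in auto)
  have d_0: "d 0 = 1"
    by (simp add: d_def)
  have d_1: "d 1 = 0"
    by (simp add: d_def det_single f_00)
  have "d (Suc n) = (- 1) ^ n * h n * (\<Prod>i<n. N i)"
  proof (induction n rule: induct_nat_012)
    case 0
    then show ?case using d_1 h_0 by simp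
  next
    case 1
    then show ?case using d_rec[of 0] d_0 d_1 h_1 up[of 0] down[of 0] by (simp add: N_0)
  next
    case (ge2 n)
    have "d (Suc (Suc (Suc n))) = - \<sigma> (Suc n) * N (Suc n) * d (Suc (Suc n)) - N (Suc n) * N (Suc n) * d (Suc n)"
      using d_rec[of "Suc n"] diag[of "Suc n"] up[of "Suc n"] down[of "Suc n"] by simp
    \<comment> \<open>One factor of \<open>N (Suc n) * N (Suc n)\<close> is rewritten as
      \<open>\<tau> (Suc n) * N n\<close>, so that both terms share the same product of norms and
      the recurrence of \<open>h\<close> appears.\<close>
    also have "\<dots> = (- 1) ^ n * (\<sigma> (Suc n) * h (Suc n) - \<tau> (Suc n) * h n) * (N (Suc n) * (N n * (\<Prod>i<n. N i)))"
      unfolding ge2 by (simp add: N_Suc algebra_simps)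
    finally show ?case
      using h_rec[of n] by (simp add: mult_ac)
  qed
  moreover have "hankel_det n b = d (Suc n)"
    by (subst hankel_det_monic_basis[of r]) (simp_all add: r d_def f_def)
  ultimately show ?thesis
    by (simp add: N_def)
qed

section \<open>Euler numbers and the moments of a product basis\<close>

text \<open>Umbrally, \<open>E (p (z + 1) + p (z - 1)) = 2 p 0\<close> encodes \<open>(e\<^sup>t + e\<^sup>-\<^sup>t) sech t = 2\<close>.\<close>

lemma euler_number_sum:
  "(\<Sum>i\<le>n. real (n choose i) * (1 + (- 1) ^ (n - i)) * euler_number i) = (if n = 0 then 2 else 0)"
proof -
  define C where "C = fps_exp 1 + fps_exp (- 1 :: real)"
  define f where "f = 2 / C"
  \<comment> \<open>The constant term of \<open>C\<close> is 2, so \<open>C\<close> is a unit and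
    the quotient satisfies \<open>f * C = 2\<close>.\<close>
  have "fps_nth C 0 \<noteq> 0"
    by (simp add: C_def)
  then have "f * C = 2"
    unfolding f_def by (subst fps_divide_unit) (simp_all add: mult.assoc inverse_mult_eq_1)
  then have "fps_nth 2 n = (\<Sum>i\<le>n. fps_nth f i * fps_nth C (n - i))"
    using fps_mult_nth[of f C n] by (simp add: atLeast0AtMost)
  then have "fact n * fps_nth 2 n = (\<Sum>i\<le>n. fact n * (fps_nth f i * fps_nth C (n - i)))"
    by (simp add: sum_distrib_left)
  also have "\<dots> = (\<Sum>i\<le>n. real (n choose i) * (1 + (- 1) ^ (n - i)) * euler_number i)"
  proof (rule sum.cong)
    fix i assume "i \<in> {..n}"
    then have "fact n = fact i * fact (n - i) * real (n choose i)"
      by (simp add: binomial_fact)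
    moreover have "fps_nth C (n - i) = (1 + (- 1) ^ (n - i)) / fact (n - i)"
      by (simp add: C_def add_divide_distrib)
    moreover have "euler_number i = fact i * fps_nth f i"
      by (simp add: euler_number_def f_def C_def)
    ultimately show "fact n * (fps_nth f i * fps_nth C (n - i)) =
        real (n choose i) * (1 + (- 1) ^ (n - i)) * euler_number i"
      by simp
  qed simp
  finally have sum: "fact n * fps_nth 2 n =
      (\<Sum>i\<le>n. real (n choose i) * (1 + (- 1) ^ (n - i)) * euler_number i)" .
  show ?thesis
    unfolding sum[symmetric] by (simp add: fps_numeral_nth)
qed

lemma monom_pcompose_linear:
  "pcompose (monom a n) [:c, 1:] = (\<Sum>i\<le>n. monom (a * real (n choose i) * c ^ (n - i)) i)"
proof -
  have "poly (pcompose (monom a n) [:c, 1:]) x =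
      poly (\<Sum>i\<le>n. monom (a * real (n choose i) * c ^ (n - i)) i) x" for x
    by (simp add: poly_pcompose poly_monom poly_sum binomial_ring[of x c n] add.commute[of c x]
      sum_distrib_left mult_ac)
  then show ?thesis
    by (intro poly_ext)
qed

lemma moment_euler_shift:
  "moment euler_number (pcompose p [:1, 1:]) + moment euler_number (pcompose p [:- 1, 1:]) =
    2 * poly p 0"
proof -
  have monom: "moment euler_number (pcompose (monom a n) [:1, 1:]) +
      moment euler_number (pcompose (monom a n) [:- 1, 1:]) = 2 * poly (monom a n) 0" for a n
  proof -
    have "moment euler_number (pcompose (monom a n) [:1, 1:]) +
      moment euler_number (pcompose (monom a n) [:- 1, 1:]) =
      a * (\<Sum>i\<le>n. real (n choose i) * (1 + (- 1) ^ (n - i)) * euler_number i)"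
      by (simp add: monom_pcompose_linear moment_sum sum_distrib_left algebra_simps
        flip: sum.distrib)
    then show ?thesis
      unfolding euler_number_sum by (simp add: poly_monom power_0_left)
  qed
  have p: "p = (\<Sum>i\<le>degree p. monom (coeff p i) i)"
    by (simp add: poly_as_sum_of_monoms)
  show ?thesis
    by (subst (1 2 3) p)
      (simp add: pcompose_sum moment_sum poly_sum monom sum_distrib_left flip: sum.distrib)
qed

text \<open>The weight \<open>2 * k + 1\<close> comes from differentiating
  \<open>x * p (x\<^sup>2)\<close>, which sends \<open>x ^ k\<close> to
  \<open>(2 * k + 1) * x ^ (2 * k)\<close>.\<close>

lemma moment_odd_euler:
  "moment (\<lambda>k. (2 * real k + 1) * euler_number (2 * k)) p =
    moment euler_number (pderiv (pCons 0 (pcompose p [:0, 0, 1:])))"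
proof -
  have sq: "[:0, 0, 1:] = (monom 1 2 :: real poly)"
    by (simp add: numeral_2_eq_2 monom_Suc monom_0)
  have monom: "pderiv (pCons 0 (pcompose (monom a k) [:0, 0, 1:])) =
      monom ((2 * real k + 1) * a) (2 * k)" for a k
  proof -
    have "pcompose (monom a k) [:0, 0, 1:] = monom a (2 * k)"
      unfolding sq by (rule poly_ext) (simp add: poly_pcompose poly_monom power_mult)
    then show ?thesis
      by (simp add: monom_Suc[symmetric] pderiv_monom)
  qed
  have p: "p = (\<Sum>i\<le>degree p. monom (coeff p i) i)"
    by (simp add: poly_as_sum_of_monoms)
  have shift: "pCons 0 q = monom 1 1 * q" for q :: "real poly"
    by (simp add: monom_Suc monom_0)
  have "pCons 0 (\<Sum>i\<in>A. f i) = (\<Sum>i\<in>A. pCons 0 (f i))" for A :: "nat set" and f :: "nat \<Rightarrow> real poly"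
    unfolding shift by (rule sum_distrib_left)
  moreover have "pderiv (\<Sum>i\<in>A. f i) = (\<Sum>i\<in>A. pderiv (f i))" for A :: "nat set" and f :: "nat \<Rightarrow> real poly"
    by (induction A rule: infinite_finite_induct) (simp_all add: pderiv_add)
  ultimately show ?thesis
    by (subst (1 2) p) (simp add: pcompose_sum moment_sum monom mult_ac)
qed

text \<open>At \<open>x = z\<^sup>2\<close> each factor splits as
  \<open>(2 * j + 1 - z) * (2 * j + 1 + z)\<close>, which makes this basis compatible with the
  shifts \<open>z + 1\<close> and \<open>z - 1\<close>.\<close>

definition odd_prod :: "nat \<Rightarrow> real poly" where
  "odd_prod k = (\<Prod>j<k. [:(2 * real j + 1)\<^sup>2, - 1:])"

text \<open>The odd polynomial \<open>Q\<close> is chosen so that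
  \<open>Q (z + 1) + Q (z - 1) = 2 * z * R z\<close>. Differentiating and applying
  \<open>moment_euler_shift\<close> reduces the moment to the derivative of \<open>Q\<close> at 0,
  which is \<open>W 0\<close>.\<close>

lemma moment_odd_prod:
  "moment (\<lambda>k. (2 * real k + 1) * euler_number (2 * k)) (odd_prod k) = 4 ^ k * (fact k)\<^sup>2"
proof -
  define W :: "real poly" where "W = (\<Prod>j<k. [:(2 * real j + 2)\<^sup>2, 0, - 1:])"
  define Q where "Q = pCons 0 W"
  define R where "R = pcompose (odd_prod k) [:0, 0, 1:]"
  have R: "poly R z = (\<Prod>j<k. (2 * real j + 1)\<^sup>2 - z\<^sup>2)" for z
    by (simp add: R_def odd_prod_def poly_pcompose poly_prod power2_eq_square)
  have W: "poly W z = (\<Prod>j<k. (2 * real j + 2)\<^sup>2 - z\<^sup>2)" for z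
    by (simp add: W_def poly_prod power2_eq_square)
  \<comment> \<open>Both products contain the factors \<open>2 * j + 1 - z\<close>; the remaining
    quotients \<open>(z + 2 * j + 3) / (z + 2 * j + 1)\<close> telescope.\<close>
  have plus: "(z + 1) * (\<Prod>j<m. (2 * real j + 2)\<^sup>2 - (z + 1)\<^sup>2) =
      (z + 2 * real m + 1) * (\<Prod>j<m. (2 * real j + 1)\<^sup>2 - z\<^sup>2)" for z m
  proof (induction m)
    case (Suc m)
    define P where "P = (\<Prod>j<m. (2 * real j + 1)\<^sup>2 - z\<^sup>2)"
    have "(z + 1) * (\<Prod>j<Suc m. (2 * real j + 2)\<^sup>2 - (z + 1)\<^sup>2) =
        (z + 2 * real m + 1) * P * ((2 * real m + 2)\<^sup>2 - (z + 1)\<^sup>2)"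
      unfolding P_def Suc.IH[symmetric] by (simp add: mult.assoc)
    also have "\<dots> = (z + 2 * real (Suc m) + 1) * (P * ((2 * real m + 1)\<^sup>2 - z\<^sup>2))"
      by (simp add: power2_eq_square algebra_simps)
    finally show ?case
      by (simp add: P_def)
  qed simp
  have minus: "(z - 1) * (\<Prod>j<m. (2 * real j + 2)\<^sup>2 - (z - 1)\<^sup>2) =
      (z - 2 * real m - 1) * (\<Prod>j<m. (2 * real j + 1)\<^sup>2 - z\<^sup>2)" for z m
    using plus[of "- z" m] by (simp add: power2_commute[of 1 z] algebra_simps)
  \<comment> \<open>The prefactors of \<open>plus\<close> and \<open>minus\<close> add up to
    \<open>2 * z\<close>.\<close>
  have "pcompose Q [:1, 1:] + pcompose Q [:- 1, 1:] = smult 2 (pCons 0 R)"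
  proof (rule poly_ext)
    fix z :: real
    show "poly (pcompose Q [:1, 1:] + pcompose Q [:- 1, 1:]) z = poly (smult 2 (pCons 0 R)) z"
      using plus[of z k] minus[of z k]
      by (simp add: Q_def poly_pcompose W R add.commute algebra_simps)
  qed
  then have "pderiv (pcompose Q [:1, 1:]) + pderiv (pcompose Q [:- 1, 1:]) = smult 2 (pderiv (pCons 0 R))"
    by (metis pderiv_add pderiv_smult)
  moreover have "pderiv (pcompose Q [:a, 1:]) = pcompose (pderiv Q) [:a, 1:]" for a
    by (simp add: pderiv_pcompose pderiv_pCons)
  ultimately have "2 * moment euler_number (pderiv (pCons 0 R)) = 2 * poly (pderiv Q) 0"
    using moment_euler_shift[of "pderiv Q"] by (metis moment_add moment_smult)
  moreover have "poly (pderiv Q) 0 = poly W 0"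
    by (simp add: Q_def pderiv_pCons)
  moreover have "poly W 0 = 4 ^ k * (fact k)\<^sup>2"
    unfolding W by (induction k) (simp_all add: power2_eq_square algebra_simps)
  ultimately show ?thesis
    by (simp add: moment_odd_euler R_def)
qed

section \<open>Explicit expansion of the orthogonal polynomials\<close>

text \<open>The three-term recurrence is that of the continuous dual Hahn polynomials with parameters
  \<open>1/2, 1/2, 1/2\<close>, rescaled; the expansion below is their \<open>\<^sub>3F\<^sub>2\<close> representation.\<close>

lemma opoly_odd_prod_expansion:
  "opoly (\<lambda>n. 8 * real n ^ 2 + 8 * real n + 3) (\<lambda>n. (2 * real n) ^ 4) n =
    smult (4 ^ n * (fact n)\<^sup>2)
      (\<Sum>k\<le>n. smult ((- 1) ^ k * real (n choose k) / (4 ^ k * (fact k)\<^sup>2)) (odd_prod k))"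
proof -
  define \<sigma> \<tau> where "\<sigma> = (\<lambda>n. 8 * real n ^ 2 + 8 * real n + 3)" and "\<tau> = (\<lambda>n. (2 * real n) ^ 4)"
  define S where "S y k = (- 1) ^ k * poly (odd_prod k) y / (4 ^ k * (fact k)\<^sup>2)" for y k
  define u where "u y n = (\<Sum>k\<le>n. real (n choose k) * S y k)" for y n
  \<comment> \<open>Binomials above the diagonal vanish, so sums for different \<open>n\<close> can
    share one range.\<close>
  have u_eq: "u y n = (\<Sum>k\<le>m. real (n choose k) * S y k)" if "n \<le> m" for y n m
    unfolding u_def by (rule sum.mono_neutral_left) (use that in auto)
  have S_Suc: "4 * (real k + 1)\<^sup>2 * S y (Suc k) = (y - (2 * real k + 1)\<^sup>2) * S y k" for y k
  proof -
    define P D where "P = poly (odd_prod k) y" and "D = (4 ^ k * (fact k)\<^sup>2 :: real)"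
    have P: "poly (odd_prod (Suc k)) y = - ((y - (2 * real k + 1)\<^sup>2) * P)"
      by (simp add: P_def odd_prod_def algebra_simps)
    have D: "(4 ^ Suc k * (fact (Suc k))\<^sup>2 :: real) = 4 * (real k + 1)\<^sup>2 * D"
      by (simp add: D_def power_mult_distrib add.commute)
    have "S y (Suc k) = (- 1) ^ k * ((y - (2 * real k + 1)\<^sup>2) * P) / (4 * (real k + 1)\<^sup>2 * D)"
      unfolding S_def P D by simp
    moreover have "S y k = (- 1) ^ k * P / D"
      by (simp add: S_def P_def D_def)
    moreover have "real k + 1 \<noteq> 0" "D \<noteq> 0"
      by (simp_all add: D_def add_nonneg_eq_0_iff)
    ultimately show ?thesis
      by simp
  qed
  \<comment> \<open>This compares coefficients of \<open>S y k\<close> in \<open>rec\<close>, using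
    \<open>S_Suc\<close> to write \<open>y * S y k\<close> in terms of \<open>S y k\<close> and
    \<open>S y (Suc k)\<close>.\<close>
  have coef: "4 * (real n + 2)\<^sup>2 * real (Suc (Suc n) choose k) =
      ((2 * real k + 1)\<^sup>2 + \<sigma> (Suc n)) * real (Suc n choose k)
      + (if k = 0 then 0 else 4 * (real k)\<^sup>2 * real (Suc n choose (k - 1)))
      - 4 * (real n + 1)\<^sup>2 * real (n choose k)" for n k
  proof (cases k)
    case 0
    then show ?thesis by (simp add: \<sigma>_def power2_eq_square algebra_simps)
  next
    case (Suc j)
    \<comment> \<open>\<open>Z\<close> is \<open>n choose (j - 1)\<close> for positive
      \<open>j\<close> and 0 for \<open>j = 0\<close>; the difference avoids truncated
      subtraction.\<close>
    define A B Z where "A = real (n choose j)" and "B = real (n choose Suc j)"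
      and "Z = real (Suc n choose j) - real (n choose j)"
    have B: "(real j + 1) * B = (real n - real j) * A"
      using gbinomial_absorb_comp[of "real n" j] gbinomial_absorption[of j "real n"]
      by (simp add: A_def B_def binomial_gbinomial add.commute)
    have Z: "real j * A = (real n - real j + 1) * Z"
    proof (cases j)
      case 0
      then show ?thesis by (simp add: Z_def)
    next
      case (Suc i)
      then show ?thesis
        using gbinomial_absorb_comp[of "real n" i] gbinomial_absorption[of i "real n"]
        by (simp add: A_def Z_def binomial_gbinomial add.commute)
    qed
    \<comment> \<open>The last two lines are multiples of the relations \<open>Z\<close> and
      \<open>B\<close>, hence zero; their multipliers are forced by comparing the coefficients of
      \<open>Z\<close> and \<open>B\<close>.\<close>
    have "4 * (real n + 2)\<^sup>2 * (Z + 2 * A + B) =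
        ((2 * real j + 3)\<^sup>2 + 8 * (real n + 1)\<^sup>2 + 8 * (real n + 1) + 3) * (A + B)
        + 4 * (real j + 1)\<^sup>2 * (Z + A) - 4 * (real n + 1)\<^sup>2 * B
        + 4 * (real n + real j + 3) * ((real n - real j + 1) * Z - real j * A)
        - 4 * (real j + 2) * ((real j + 1) * B - (real n - real j) * A)"
      by (simp add: power2_eq_square algebra_simps)
    then have "4 * (real n + 2)\<^sup>2 * (Z + 2 * A + B) =
        ((2 * real j + 3)\<^sup>2 + 8 * (real n + 1)\<^sup>2 + 8 * (real n + 1) + 3) * (A + B)
        + 4 * (real j + 1)\<^sup>2 * (Z + A) - 4 * (real n + 1)\<^sup>2 * B"
      unfolding B Z by simp
    then show ?thesis
      by (simp add: Suc \<sigma>_def A_def B_def Z_def algebra_simps)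
  qed
  \<comment> \<open>The polynomial recurrence divided by
    \<open>4 ^ (n + 1) * (fact (n + 1))\<^sup>2\<close>.\<close>
  have rec: "4 * (real n + 2)\<^sup>2 * u y (Suc (Suc n)) =
      (y + \<sigma> (Suc n)) * u y (Suc n) - 4 * (real n + 1)\<^sup>2 * u y n" for y n
  proof -
    let ?m = "Suc (Suc n)"
    have "(\<Sum>k\<le>?m. (if k = 0 then 0 else 4 * (real k)\<^sup>2 * real (Suc n choose (k - 1))) * S y k) =
        (\<Sum>k\<le>Suc n. real (Suc n choose k) * (4 * (real k + 1)\<^sup>2 * S y (Suc k)))"
      by (subst sum.atMost_Suc_shift) (simp add: mult_ac add.commute)
    also have "\<dots> = (\<Sum>k\<le>Suc n. (y - (2 * real k + 1)\<^sup>2) * (real (Suc n choose k) * S y k))"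
      unfolding S_Suc by (simp add: mult_ac)
    also have "\<dots> = (\<Sum>k\<le>?m. (y - (2 * real k + 1)\<^sup>2) * (real (Suc n choose k) * S y k))"
      by (subst sum.atMost_Suc[of _ "Suc n"])
        (simp add: binomial_eq_0 del: binomial_Suc_Suc sum.atMost_Suc)
    finally have shift: "(\<Sum>k\<le>?m. (if k = 0 then 0 else 4 * (real k)\<^sup>2 * real (Suc n choose (k - 1))) * S y k) =
      (\<Sum>k\<le>?m. (y - (2 * real k + 1)\<^sup>2) * (real (Suc n choose k) * S y k))" .
    have "4 * (real n + 2)\<^sup>2 * u y ?m = (\<Sum>k\<le>?m. (4 * (real n + 2)\<^sup>2 * real (?m choose k)) * S y k)"
      unfolding u_def sum_distrib_left by (simp only: mult.assoc)
    also have "\<dots> = (\<Sum>k\<le>?m. ((2 * real k + 1)\<^sup>2 + \<sigma> (Suc n)) * (real (Suc n choose k) * S y k))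
        + (\<Sum>k\<le>?m. (if k = 0 then 0 else 4 * (real k)\<^sup>2 * real (Suc n choose (k - 1))) * S y k)
        - (\<Sum>k\<le>?m. 4 * (real n + 1)\<^sup>2 * (real (n choose k) * S y k))"
      unfolding coef by (simp only: ring_distribs sum.distrib sum_subtractf mult.assoc)
    also have "\<dots> = (\<Sum>k\<le>?m. (y + \<sigma> (Suc n)) * (real (Suc n choose k) * S y k))
        - (\<Sum>k\<le>?m. 4 * (real n + 1)\<^sup>2 * (real (n choose k) * S y k))"
      unfolding shift sum.distrib[symmetric] by (simp only: ring_distribs) (simp add: algebra_simps)
    also have "\<dots> = (y + \<sigma> (Suc n)) * u y (Suc n) - 4 * (real n + 1)\<^sup>2 * u y n"
      by (simp only: sum_distrib_left[symmetric] u_eq[of "Suc n" ?m] u_eq[of n ?m])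
    finally show ?thesis .
  qed
  have "poly (opoly \<sigma> \<tau> n) y = 4 ^ n * (fact n)\<^sup>2 * u y n" for y n
  proof (induction n rule: induct_nat_012)
    case 0
    then show ?case by (simp add: u_def S_def odd_prod_def)
  next
    case 1
    then show ?case by (simp add: u_def S_def odd_prod_def \<sigma>_def field_simps)
  next
    case (ge2 n)
    have "poly (opoly \<sigma> \<tau> (Suc (Suc n))) y =
        4 ^ Suc n * (fact (Suc n))\<^sup>2 * ((y + \<sigma> (Suc n)) * u y (Suc n) - 4 * (real n + 1)\<^sup>2 * u y n)"
      using ge2 by (simp add: \<tau>_def) (simp add: algebra_simps power2_eq_square power4_eq_xxxx)
    also have "\<dots> = 4 ^ Suc (Suc n) * (fact (Suc (Suc n)))\<^sup>2 * u y (Suc (Suc n))"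
      unfolding rec[symmetric] by (simp add: algebra_simps power2_eq_square)
    finally show ?case .
  qed
  then show ?thesis
    by (intro poly_ext) (simp add: \<sigma>_def \<tau>_def u_def S_def poly_sum mult_ac)
qed

text \<open>The moments of \<open>odd_prod k\<close> cancel the denominators of the expansion,
  leaving the alternating binomial sum.\<close>

lemma moment_opoly_odd_euler:
  "moment (\<lambda>k. (2 * real k + 1) * euler_number (2 * k))
    (opoly (\<lambda>n. 8 * real n ^ 2 + 8 * real n + 3) (\<lambda>n. (2 * real n) ^ 4) n) = (if n = 0 then 1 else 0)"
proof -
  have "moment (\<lambda>k. (2 * real k + 1) * euler_number (2 * k))
      (opoly (\<lambda>n. 8 * real n ^ 2 + 8 * real n + 3) (\<lambda>n. (2 * real n) ^ 4) n) =
      4 ^ n * (fact n)\<^sup>2 * (\<Sum>k\<le>n. (- 1) ^ k * real (n choose k))"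
    unfolding opoly_odd_prod_expansion by (simp add: moment_smult moment_sum moment_odd_prod)
  then show ?thesis
    using choose_alternating_sum[of n, where ?'a = real] by (cases "n = 0") auto
qed

theorem proposition3p5:
  fixes b h :: "nat \<Rightarrow> real" and n :: nat
  assumes b_0: "b 0 = 0"
    and b_pos: "\<And>k. k \<ge> 1 \<Longrightarrow> b k = (2 * real k - 1) * euler_number (2 * k - 2)"
    and h_0: "h 0 = 0"
    and h_1: "h 1 = 1"
    and h_rec: "\<And>m. m \<ge> 1 \<Longrightarrow>
      h (m + 1) = (8 * real m ^ 2 + 8 * real m + 3) * h m - (2 * real m) ^ 4 * h (m - 1)"
    and n: "n \<ge> 1"
  shows "hankel_det n b =
    (- 1) ^ n / (2 ^ n * fact n) ^ 4 * h n *
      hankel_det n (\<lambda>k. (2 * real k + 1) * euler_number (2 * k))"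
proof -
  let ?c = "\<lambda>k. (2 * real k + 1) * euler_number (2 * k)"
  let ?\<sigma> = "\<lambda>n. 8 * real n ^ 2 + 8 * real n + 3" and ?\<tau> = "\<lambda>n. (2 * real n) ^ 4"
  have b_Suc: "(\<lambda>k. b (Suc k)) = ?c"
    by (simp add: b_pos algebra_simps)
  have N: "(\<Prod>k<m. ?\<tau> (Suc k)) = (2 ^ m * fact m) ^ 4" for m
  proof (induction m)
    case (Suc m)
    have "2 ^ m * fact m * (2 * real (Suc m)) = (2 ^ Suc m * fact (Suc m) :: real)"
      by simp
    then show ?case
      by (simp only: prod.lessThan_Suc Suc power_mult_distrib[symmetric])
  qed simp
  have "hankel_det n b = (- 1) ^ n * h n * (\<Prod>i<n. \<Prod>k<i. ?\<tau> (Suc k))"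
  proof (rule hankel_det_shifted_opoly[where b = b and \<sigma> = ?\<sigma>])
    show "h (m + 2) = ?\<sigma> (m + 1) * h (m + 1) - ?\<tau> (m + 1) * h m" for m
      using h_rec[of "m + 1"] by simp
  qed (simp_all only: b_Suc moment_opoly_odd_euler b_0 h_0 h_1)
  \<comment> \<open>This product runs over \<open>i \<le> n\<close>, one index further than the one
    for \<open>b\<close>; the extra factor is the denominator in the claim.\<close>
  moreover have "hankel_det n ?c = (\<Prod>i<n. \<Prod>k<i. ?\<tau> (Suc k)) * (2 ^ n * fact n) ^ 4"
    unfolding hankel_det_opoly[OF moment_opoly_odd_euler] N
    by (simp flip: lessThan_Suc_atMost)
  ultimately show ?thesis
    by simp
qed

end
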